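(* Suppose $\mathcal{G}$ is an equationally noetherian family of groups and $(\alpha_j\colon L_j\to L_{j+1})_{j\ge 1}$ is a sequence of surjective homomorphisms where each $L_j$ is a $\mathcal{G}$-limit group. Then $\alpha_j$ is an isomorphism for all but finitely many $j$.
   Context: A family $\mathcal{G}$ of groups is equationally noetherian if for every $n$ and every subset $S$ of the free group $F_n=F(x_1,\dots,x_n)$ there is a finite $S_0\subseteq S$ with $V_{\mathcal{G}}(S_0)=V_{\mathcal{G}}(S)$, where $V_{\mathcal{G}}(S)=\{(g_1,\dots,g_n)\in\Gamma^n : \Gamma\in\mathcal{G},\ W(g_1,\dots,g_n)=1\ \forall W\in S\}$. $\omega$ is a fixed non-principal ultrafilter on $\mathbb{N}$; "$\omega$-almost surely" means for a set of indices of $\omega$-measure $1$. $\mathrm{Hom}(G,\mathcal{G})=\bigcup_{\Gamma\in\mathcal{G}}\mathrm{Hom}(G,\Gamma)$. For a sequence $(\phi_i)$ from $\mathrm{Hom}(G,\mathcal{G})$, $\ker^\omega(\phi_i)=\{g\in G:\phi_i(g)=1\ \omega\text{-almost surely}\}$. A $\mathcal{G}$-limit group is a group of the form $G/\ker^\omega(\phi_i)$ with $G$ a finitely generated group and $(\phi_i)$ a sequence from $\mathrm{Hom}(G,\mathcal{G})$. *)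

theory Defs
  imports "HOL-Algebra.Algebra"
begin

section \<open>The free group \<open>F\<^sub>n\<close>\<close>

text \<open>
  The free group on \<open>x\<^sub>1, \<dots>, x\<^sub>n\<close> consists of the reduced words.
  The letter \<open>(i, True)\<close> stands for \<open>x\<^sub>i\<close> and \<open>(i, False)\<close> for its inverse.
\<close>

type_synonym letter = "nat \<times> bool"

definition inv_letter :: "letter \<Rightarrow> letter" where
  "inv_letter a = (fst a, \<not> snd a)"

fun reduced :: "letter list \<Rightarrow> bool" where
  "reduced [] \<longleftrightarrow> True"
| "reduced [a] \<longleftrightarrow> True"
| "reduced (a # b # w) \<longleftrightarrow> b \<noteq> inv_letter a \<and> reduced (b # w)"

fun push_letter :: "letter \<Rightarrow> letter list \<Rightarrow> letter list" where
  "push_letter a [] = [a]"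
| "push_letter a (b # w) = (if b = inv_letter a then w else a # b # w)"

definition free_group :: "nat \<Rightarrow> letter list monoid" where
  "free_group n =
     \<lparr>carrier = {w. reduced w \<and> fst ` set w \<subseteq> {1..n}}, monoid.mult = foldr push_letter, one = []\<rparr>"

text \<open>The value \<open>W(g\<^sub>1, \<dots>, g\<^sub>n)\<close> of a word in a group.\<close>

definition letter_value :: "('a, 'b) monoid_scheme \<Rightarrow> (nat \<Rightarrow> 'a) \<Rightarrow> letter \<Rightarrow> 'a" where
  "letter_value \<Gamma> g a = (if snd a then g (fst a) else inv\<^bsub>\<Gamma>\<^esub> (g (fst a)))"

definition word_value :: "('a, 'b) monoid_scheme \<Rightarrow> (nat \<Rightarrow> 'a) \<Rightarrow> letter list \<Rightarrow> 'a" where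
  "word_value \<Gamma> g w = foldr (\<lambda>a x. letter_value \<Gamma> g a \<otimes>\<^bsub>\<Gamma>\<^esub> x) w \<one>\<^bsub>\<Gamma>\<^esub>"

lemma inv_letter_inv_letter [simp]: "inv_letter (inv_letter a) = a"
  by (simp add: inv_letter_def)

lemma fst_inv_letter [simp]: "fst (inv_letter a) = fst a"
  by (simp add: inv_letter_def)

lemma reduced_ConsD: "reduced (a # w) \<Longrightarrow> reduced w"
  by (cases w) auto

lemma reduced_push_letter: "reduced w \<Longrightarrow> reduced (push_letter a w)"
  by (cases w) (auto dest: reduced_ConsD)

lemma push_letter_reduced: "reduced (a # w) \<Longrightarrow> push_letter a w = a # w"
  by (cases w) auto

lemma push_letter_cancel:
  assumes "reduced w"
  shows "push_letter (inv_letter a) (push_letter a w) = w"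
proof (cases w)
  case (Cons b v)
  show ?thesis
  proof (cases "b = inv_letter a")
    case True
    with Cons assms push_letter_reduced[of b v] show ?thesis by simp
  qed (use Cons in simp)
qed simp

lemma push_letter_cancel':
  "reduced w \<Longrightarrow> push_letter a (push_letter (inv_letter a) w) = w"
  using push_letter_cancel[of w "inv_letter a"] by simp

lemma letters_push_letter: "set (push_letter a w) \<subseteq> insert a (set w)"
  by (cases w) auto

lemma reduced_foldr_push: "reduced w \<Longrightarrow> reduced (foldr push_letter u w)"
  by (induction u) (auto intro: reduced_push_letter)

lemma letters_foldr_push: "set (foldr push_letter u w) \<subseteq> set u \<union> set w"
proof (induction u)
  case (Cons a u)
  with letters_push_letter[of a "foldr push_letter u w"] show ?case by auto
qed simp

lemma foldr_push_Nil: "reduced w \<Longrightarrow> foldr push_letter w [] = w"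
proof (induction w)
  case (Cons a w)
  with reduced_ConsD[of a w] push_letter_reduced[of a w] show ?case by simp
qed simp

lemma foldr_push_push:
  assumes "reduced w"
  shows "foldr push_letter (push_letter a u) w = push_letter a (foldr push_letter u w)"
proof (cases u)
  case (Cons b v)
  have "reduced (foldr push_letter v w)"
    using assms by (rule reduced_foldr_push)
  with Cons show ?thesis
    by (auto simp: push_letter_cancel')
qed simp

lemma foldr_push_assoc:
  assumes "reduced w"
  shows "foldr push_letter (foldr push_letter u v) w = foldr push_letter u (foldr push_letter v w)"
  by (induction u) (simp_all add: foldr_push_push[OF assms])

lemma foldr_push_inverse:
  "reduced v \<Longrightarrow> foldr push_letter (rev (map inv_letter w)) (foldr push_letter w v) = v"
proof (induction w arbitrary: v)
  case (Cons a w)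
  have "reduced (foldr push_letter w v)"
    using Cons.prems by (rule reduced_foldr_push)
  then show ?case
    using Cons by (simp add: push_letter_cancel)
qed simp

theorem group_free_group: "group (free_group n)"
proof (rule groupI)
  fix u v assume "u \<in> carrier (free_group n)" "v \<in> carrier (free_group n)"
  then show "u \<otimes>\<^bsub>free_group n\<^esub> v \<in> carrier (free_group n)"
    using letters_foldr_push[of u v] by (fastforce simp: free_group_def reduced_foldr_push)
next
  fix w assume w: "w \<in> carrier (free_group n)"
  let ?v = "foldr push_letter (rev (map inv_letter w)) []"
  have "?v \<in> carrier (free_group n)"
    using w letters_foldr_push[of "rev (map inv_letter w)" "[]"]
    by (fastforce simp: free_group_def reduced_foldr_push)
  moreover have "foldr push_letter ?v w = []"
  proof -
    have "foldr push_letter ?v w = foldr push_letter (rev (map inv_letter w)) w"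
      using w foldr_push_assoc[of w "rev (map inv_letter w)" "[]"] by (simp add: free_group_def)
    also have "\<dots> = []"
      using w foldr_push_inverse[of "[]" w] foldr_push_Nil[of w] by (simp add: free_group_def)
    finally show ?thesis .
  qed
  ultimately show "\<exists>v\<in>carrier (free_group n). v \<otimes>\<^bsub>free_group n\<^esub> w = \<one>\<^bsub>free_group n\<^esub>"
    by (auto simp: free_group_def)
qed (auto simp: free_group_def foldr_push_assoc)

lemma (in group) word_value_closed:
  assumes "g \<in> {1..n} \<rightarrow> carrier G" "fst ` set w \<subseteq> {1..n}"
  shows "word_value G g w \<in> carrier G"
  using assms(2)
proof (induction w)
  case (Cons a w)
  then have "g (fst a) \<in> carrier G"
    using assms(1) by (intro Pi_mem[of g "{1..n}"]) auto
  with Cons show ?case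
    by (auto simp: word_value_def letter_value_def)
qed (simp add: word_value_def)

lemma (in group) word_value_push_letter:
  assumes "g \<in> {1..n} \<rightarrow> carrier G" "fst a \<in> {1..n}" "fst ` set w \<subseteq> {1..n}"
  shows "word_value G g (push_letter a w) = letter_value G g a \<otimes> word_value G g w"
proof (cases w)
  case (Cons b v)
  have "g (fst a) \<in> carrier G" "word_value G g v \<in> carrier G"
    using assms Cons word_value_closed[of g n v] by auto
  then show ?thesis
    using Cons
    by (auto simp: word_value_def letter_value_def inv_letter_def m_assoc[symmetric])
qed (simp add: word_value_def)

theorem (in group) word_value_hom:
  assumes g: "g \<in> {1..n} \<rightarrow> carrier G"
  shows "word_value G g \<in> hom (free_group n) G"
proof (rule homI)
  fix u v assume uv: "u \<in> carrier (free_group n)" "v \<in> carrier (free_group n)"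
  have v: "fst ` set v \<subseteq> {1..n}" using uv by (simp add: free_group_def)
  have "fst ` set u \<subseteq> {1..n} \<Longrightarrow>
      word_value G g (foldr push_letter u v) = word_value G g u \<otimes> word_value G g v"
  proof (induction u)
    case Nil
    then show ?case
      using word_value_closed[OF g v] by (simp add: word_value_def)
  next
    case (Cons a u)
    have *: "fst ` set (foldr push_letter u v) \<subseteq> {1..n}"
      using Cons.prems v letters_foldr_push[of u v] by fastforce
    have "letter_value G g a \<in> carrier G"
      using Cons.prems Pi_mem[OF g, of "fst a"] by (auto simp: letter_value_def)
    moreover have "word_value G g u \<in> carrier G" "word_value G g v \<in> carrier G"
      using Cons.prems v word_value_closed[OF g, of u] word_value_closed[OF g, of v] by auto
    ultimately show ?case
      using Cons word_value_push_letter[OF g _ *, of a]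
      by (simp add: m_assoc) (simp add: word_value_def m_assoc)
  qed
  then show "word_value G g (u \<otimes>\<^bsub>free_group n\<^esub> v) = word_value G g u \<otimes> word_value G g v"
    using uv by (simp add: free_group_def)
qed (use word_value_closed[OF g] in \<open>simp add: free_group_def\<close>)

section \<open>Equationally noetherian families\<close>

text \<open>
  The points of \<open>V\<^sub>\<G>(S)\<close> are tagged with the group they live in, since different members of
  the family may share elements of the underlying type.
\<close>

definition solutions :: "'a monoid set \<Rightarrow> nat \<Rightarrow> letter list set \<Rightarrow> ('a monoid \<times> (nat \<Rightarrow> 'a)) set" where
  "solutions \<G> n S =
     {(\<Gamma>, g). \<Gamma> \<in> \<G> \<and> g \<in> {1..n} \<rightarrow>\<^sub>E carrier \<Gamma> \<and> (\<forall>W\<in>S. word_value \<Gamma> g W = \<one>\<^bsub>\<Gamma>\<^esub>)}"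

definition equationally_noetherian :: "'a monoid set \<Rightarrow> bool" where
  "equationally_noetherian \<G> \<longleftrightarrow>
     (\<forall>n. \<forall>S \<subseteq> carrier (free_group n).
        \<exists>S\<^sub>0 \<subseteq> S. finite S\<^sub>0 \<and> solutions \<G> n S\<^sub>0 = solutions \<G> n S)"

section \<open>Limit groups\<close>

definition nonprincipal_ultrafilter :: "'i filter \<Rightarrow> bool" where
  "nonprincipal_ultrafilter \<omega> \<longleftrightarrow>
     \<omega> \<noteq> bot \<and>
     (\<forall>P. eventually P \<omega> \<or> eventually (\<lambda>i. \<not> P i) \<omega>) \<and>
     (\<forall>i. \<omega> \<noteq> principal {i})"

text \<open>A homomorphism into a member of the family is recorded together with its codomain.\<close>

definition Hom_family :: "'g monoid \<Rightarrow> 'a monoid set \<Rightarrow> ('a monoid \<times> ('g \<Rightarrow> 'a)) set" where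
  "Hom_family G \<G> = (SIGMA \<Gamma>:\<G>. hom G \<Gamma>)"

definition stable_kernel ::
    "'i filter \<Rightarrow> 'g monoid \<Rightarrow> ('i \<Rightarrow> 'a monoid \<times> ('g \<Rightarrow> 'a)) \<Rightarrow> 'g set" where
  "stable_kernel \<omega> G \<Phi> =
     {g \<in> carrier G. eventually (\<lambda>i. snd (\<Phi> i) g = \<one>\<^bsub>fst (\<Phi> i)\<^esub>) \<omega>}"

definition finitely_generated_group :: "'g monoid \<Rightarrow> bool" where
  "finitely_generated_group G \<longleftrightarrow>
     group G \<and> (\<exists>A \<subseteq> carrier G. finite A \<and> generate G A = carrier G)"

text \<open>
  HOL cannot quantify over the type \<open>'g\<close> of the source group inside a definition, so it is passed
  as an argument.  Finitely generated groups are countable, so \<open>'g = nat\<close> already yields every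
  limit group up to isomorphism.
\<close>

definition limit_group :: "'g itself \<Rightarrow> nat filter \<Rightarrow> 'a monoid set \<Rightarrow> 'l monoid \<Rightarrow> bool" where
  "limit_group _ \<omega> \<G> L \<longleftrightarrow>
     group L \<and>
     (\<exists>(G :: 'g monoid) \<Phi>.
        finitely_generated_group G \<and> (\<forall>i. \<Phi> i \<in> Hom_family G \<G>) \<and>
        L \<cong> G Mod stable_kernel \<omega> G \<Phi>)"

theorem stable_kernel_normal:
  assumes "group G" and \<G>: "\<And>\<Gamma>. \<Gamma> \<in> \<G> \<Longrightarrow> group \<Gamma>" and \<Phi>: "\<And>i. \<Phi> i \<in> Hom_family G \<G>"
  shows "stable_kernel \<omega> G \<Phi> \<lhd> G"
proof -
  interpret G: group G by fact
  let ?K = "\<lambda>i. kernel G (fst (\<Phi> i)) (snd (\<Phi> i))"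
  have "group_hom G (fst (\<Phi> i)) (snd (\<Phi> i))" for i
    using \<Phi>[of i] \<G> G.is_group by (auto simp: Hom_family_def group_hom_def group_hom_axioms_def)
  then have K: "?K i \<lhd> G" for i
    by (rule group_hom.normal_kernel)
  then have sub: "subgroup (?K i) G" for i
    by (rule normal_imp_subgroup)
  have mem: "x \<in> stable_kernel \<omega> G \<Phi> \<longleftrightarrow> x \<in> carrier G \<and> eventually (\<lambda>i. x \<in> ?K i) \<omega>" for x
    by (auto simp: stable_kernel_def kernel_def)
  show ?thesis
  proof (rule G.normal_invI)
    show "subgroup (stable_kernel \<omega> G \<Phi>) G"
    proof (rule G.subgroupI)
      show "stable_kernel \<omega> G \<Phi> \<noteq> {}"
        using mem[of "\<one>\<^bsub>G\<^esub>"] subgroup.one_closed[OF sub] by auto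
    next
      fix x assume "x \<in> stable_kernel \<omega> G \<Phi>"
      then show "inv\<^bsub>G\<^esub> x \<in> stable_kernel \<omega> G \<Phi>"
        unfolding mem by (auto elim!: eventually_mono intro: subgroup.m_inv_closed[OF sub])
    next
      fix x y assume "x \<in> stable_kernel \<omega> G \<Phi>" "y \<in> stable_kernel \<omega> G \<Phi>"
      then show "x \<otimes>\<^bsub>G\<^esub> y \<in> stable_kernel \<omega> G \<Phi>"
        unfolding mem using subgroup.m_closed[OF sub]
          by (auto simp: eventually_conj_iff[symmetric] elim: eventually_elim2)
    qed (auto simp: mem)
  next
    fix x h assume "x \<in> carrier G" "h \<in> stable_kernel \<omega> G \<Phi>"
    then show "x \<otimes>\<^bsub>G\<^esub> h \<otimes>\<^bsub>G\<^esub> inv\<^bsub>G\<^esub> x \<in> stable_kernel \<omega> G \<Phi>"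
      unfolding mem by (auto elim!: eventually_mono intro: normal.inv_op_closed2[OF K])
  qed
qed

end

theory Submission
  imports Defs
begin

text \<open>
  The group \<open>L 1\<close> is finitely generated. Choose a tuple of generators and push it forward along the
  surjections \<open>\<alpha> j\<close>; its images \<open>g j\<close> generate every \<open>L j\<close>, so \<open>L j\<close> is a quotient of one free
  group \<open>F\<^sub>n\<close>. Let \<open>R j\<close> be the set of relations, that is, the words that vanish at \<open>g j\<close>. These
  sets increase with \<open>j\<close>, and \<open>\<alpha> j\<close> is injective as soon as \<open>R (Suc j) = R j\<close>. So the claim is that the
  chain \<open>R j\<close> becomes stationary.

  Let \<open>S\<close> be the union of the chain. The noetherian condition gives a finite \<open>S\<^sub>0 \<subseteq> S\<close> with the
  same solutions in the members of \<open>\<G>\<close>, and by finiteness \<open>S\<^sub>0 \<subseteq> R J\<close> for some \<open>J\<close>. If \<open>j \<ge> J\<close>,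
  then \<open>g j\<close> solves \<open>S\<^sub>0\<close>. It lies in \<open>L j\<close>, which need not belong to \<open>\<G>\<close>; but a limit group still
  obeys every implication from finitely many equations to an equation that holds throughout \<open>\<G>\<close>
  (\<open>limit_group_inherits_consequences\<close>). Hence \<open>g j\<close> solves all of \<open>S\<close>, which says \<open>R j = S\<close>.

  The two other facts about words are that homomorphisms commute with evaluation
  (\<open>hom_word_value\<close>) and that every element is the value of a word in the generators
  (\<open>word_value_surj\<close>).
\<close>

section \<open>Values of words\<close>

lemma word_value_cong:
  assumes "fst ` set w \<subseteq> {1..n}" and "\<And>k. k \<in> {1..n} \<Longrightarrow> g k = g' k"
  shows "word_value \<Gamma> g w = word_value \<Gamma> g' w"
  using assms(1) by (induction w) (auto simp: word_value_def letter_value_def assms(2))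

lemma (in group_hom) hom_word_value:
  assumes "g \<in> {1..n} \<rightarrow> carrier G" and "fst ` set w \<subseteq> {1..n}"
  shows "h (word_value G g w) = word_value H (h \<circ> g) w"
  using assms(2)
proof (induction w)
  case Nil
  then show ?case by (simp add: word_value_def)
next
  case (Cons a w)
  have a: "g (fst a) \<in> carrier G"
    using Cons.prems assms(1) by (intro Pi_mem[OF assms(1)]) auto
  then have "h (letter_value G g a) = letter_value H (h \<circ> g) a"
    by (simp add: letter_value_def)
  moreover have "letter_value G g a \<in> carrier G" "word_value G g w \<in> carrier G"
    using a Cons.prems G.word_value_closed[OF assms(1)] by (auto simp: letter_value_def)
  ultimately show ?case
    using Cons by (simp add: word_value_def comp_def)
qed

text \<open>
  The values of all words form a subgroup, being the image of the free group under a homomorphism,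
  and the one-letter words take the generators as values.
\<close>

lemma (in group) word_value_surj:
  assumes g: "g \<in> {1..n} \<rightarrow> carrier G" and gen: "generate G (g ` {1..n}) = carrier G"
  shows "word_value G g ` carrier (free_group n) = carrier G"
proof
  interpret F: group_hom "free_group n" G "word_value G g"
    using group_free_group word_value_hom[OF g]
    by (simp add: group_hom_def group_hom_axioms_def)
  show "word_value G g ` carrier (free_group n) \<subseteq> carrier G"
    by auto
  have "g k \<in> word_value G g ` carrier (free_group n)" if "k \<in> {1..n}" for k
  proof
    show "[(k, True)] \<in> carrier (free_group n)"
      using that by (simp add: free_group_def)
    show "g k = word_value G g [(k, True)]"
      using Pi_mem[OF g that] by (simp add: word_value_def letter_value_def)
  qed
  then have "generate G (g ` {1..n}) \<subseteq> word_value G g ` carrier (free_group n)"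
    by (intro generate_subgroup_incl F.img_is_subgroup) auto
  then show "carrier G \<subseteq> word_value G g ` carrier (free_group n)"
    unfolding gen .
qed

section \<open>Limit groups\<close>

text \<open>
  It is convenient to see a limit group as the target of a surjection whose kernel is the stable
  kernel, so that equations can be moved along homomorphisms without mentioning cosets.
\<close>

lemma limit_group_epimorphism:
  assumes \<G>: "\<And>\<Gamma>. \<Gamma> \<in> \<G> \<Longrightarrow> group \<Gamma>" and L: "limit_group TYPE('g) \<omega> \<G> L"
  obtains G :: "'g monoid" and \<Phi> q
  where "finitely_generated_group G" "\<forall>i. \<Phi> i \<in> Hom_family G \<G>"
    "group_hom G L q" "q ` carrier G = carrier L" "kernel G L q = stable_kernel \<omega> G \<Phi>"
proof -
  obtain G :: "'g monoid" and \<Phi> where G: "finitely_generated_group G"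
    and \<Phi>: "\<And>i. \<Phi> i \<in> Hom_family G \<G>" and iso: "L \<cong> G Mod stable_kernel \<omega> G \<Phi>"
    using L unfolding limit_group_def by blast
  define K where "K = stable_kernel \<omega> G \<Phi>"
  have gG: "group G" and gL: "group L"
    using G L by (auto simp: finitely_generated_group_def limit_group_def)
  interpret N: normal K G
    unfolding K_def by (rule stable_kernel_normal[OF gG \<G> \<Phi>])
  obtain \<psi> where \<psi>: "\<psi> \<in> iso (G Mod K) L"
    using group.iso_sym[OF gL iso] by (auto simp: is_iso_def K_def)
  interpret \<psi>: group_hom "G Mod K" L \<psi>
    using \<psi> gL N.factorgroup_is_group
    by (simp add: group_hom_def group_hom_axioms_def iso_def)
  have bij: "bij_betw \<psi> (carrier (G Mod K)) (carrier L)"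
    using \<psi> by (simp add: iso_def)
  define q where "q x = \<psi> (K #>\<^bsub>G\<^esub> x)" for x
  have coset: "K #>\<^bsub>G\<^esub> x \<in> carrier (G Mod K)" if "x \<in> carrier G" for x
    using that by (auto simp: FactGroup_def RCOSETS_def)
  have "q \<in> hom G L"
    using hom_compose[OF N.r_coset_hom_Mod, of \<psi> L] \<psi>.homh
    by (simp add: q_def[abs_def] comp_def)
  then have "group_hom G L q"
    using gG gL by (simp add: group_hom_def group_hom_axioms_def)
  moreover have "q ` carrier G = carrier L"
  proof -
    have "q ` carrier G = \<psi> ` carrier (G Mod K)"
      by (auto simp: q_def FactGroup_def RCOSETS_def)
    then show ?thesis using bij by (simp add: bij_betw_def)
  qed
  moreover have "kernel G L q = K"
  proof -
    have "q x = \<one>\<^bsub>L\<^esub> \<longleftrightarrow> x \<in> K" if x: "x \<in> carrier G" for x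
    proof -
      have "q x = \<one>\<^bsub>L\<^esub> \<longleftrightarrow> K #>\<^bsub>G\<^esub> x = \<one>\<^bsub>G Mod K\<^esub>"
        using inj_on_eq_iff[OF bij_betw_imp_inj_on[OF bij] coset[OF x] \<psi>.G.one_closed] \<psi>.hom_one
        by (simp only: q_def)
      also have "\<dots> \<longleftrightarrow> x \<in> K"
        using x N.coset_join1[OF _ x N.subgroup_axioms] N.rcos_const[OF gG]
        by (auto simp: FactGroup_def)
      finally show ?thesis .
    qed
    then show ?thesis
      using N.subset by (auto simp: kernel_def)
  qed
  ultimately show ?thesis
    using that[of G \<Phi> q] G \<Phi> by (simp add: K_def)
qed

text \<open>
  A finite tuple of generators lets the quotients of \<open>L\<close> be described by sets of words in a fixed
  number of variables, the objects that the noetherian condition is about. The tuple is the image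
  of generators of the source group.
\<close>

lemma limit_group_generating_tuple:
  assumes \<G>: "\<And>\<Gamma>. \<Gamma> \<in> \<G> \<Longrightarrow> group \<Gamma>" and L: "limit_group TYPE('g) \<omega> \<G> L"
  obtains n g where "g \<in> {1..n} \<rightarrow> carrier L" "word_value L g ` carrier (free_group n) = carrier L"
proof -
  obtain G :: "'g monoid" and \<Phi> q where G: "finitely_generated_group G"
    and q: "group_hom G L q" "q ` carrier G = carrier L"
    by (rule limit_group_epimorphism[OF \<G> L]) auto
  interpret q: group_hom G L q by fact
  obtain A where A: "A \<subseteq> carrier G" "finite A" "generate G A = carrier G"
    using G by (auto simp: finitely_generated_group_def)
  obtain f where "bij_betw f {1..card A} A"
    using ex_bij_betw_nat_finite_1[OF \<open>finite A\<close>] by blast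
  then have f: "f ` {1..card A} = A"
    by (simp add: bij_betw_def)
  have f': "f \<in> {1..card A} \<rightarrow> carrier G"
    using f A(1) by blast
  have "word_value L (q \<circ> f) ` carrier (free_group (card A))
      = q ` word_value G f ` carrier (free_group (card A))"
    unfolding image_image
    by (intro image_cong refl q.hom_word_value[OF f', symmetric]) (simp add: free_group_def)
  also have "\<dots> = carrier L"
    using q.G.word_value_surj[OF f'] A(3) f q(2) by simp
  finally have "word_value L (q \<circ> f) ` carrier (free_group (card A)) = carrier L" .
  moreover have "q \<circ> f \<in> {1..card A} \<rightarrow> carrier L"
    using Pi_mem[OF f'] by (intro Pi_I) simp
  ultimately show ?thesis
    by (intro that)
qed

text \<open>
  Lift the tuple to \<open>u\<close> in the source \<open>G\<close> of the homomorphisms \<open>\<Phi> i\<close> that define the limit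
  group. An equation holds at the tuple precisely if it holds at the image of \<open>u\<close> under \<open>\<Phi> i\<close> for
  almost all \<open>i\<close>. Since \<open>S\<close> is finite, almost all of these images solve the whole of \<open>S\<close> at
  once, and thus \<open>W\<close>, because they lie in members of \<open>\<G>\<close>.
\<close>

lemma limit_group_inherits_consequences:
  assumes \<G>: "\<And>\<Gamma>. \<Gamma> \<in> \<G> \<Longrightarrow> group \<Gamma>" and L: "limit_group TYPE('g) \<omega> \<G> L"
    and g: "g \<in> {1..n} \<rightarrow> carrier L"
    and S: "finite S" "S \<subseteq> carrier (free_group n)" and W: "W \<in> carrier (free_group n)"
    and conseq: "solutions \<G> n S \<subseteq> solutions \<G> n {W}"
    and sol: "\<And>V. V \<in> S \<Longrightarrow> word_value L g V = \<one>\<^bsub>L\<^esub>"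
  shows "word_value L g W = \<one>\<^bsub>L\<^esub>"
proof -
  obtain G :: "'g monoid" and \<Phi> q
    where "finitely_generated_group G" and \<Phi>: "\<forall>i. \<Phi> i \<in> Hom_family G \<G>"
    and q: "group_hom G L q" "q ` carrier G = carrier L"
    and ker: "kernel G L q = stable_kernel \<omega> G \<Phi>"
    by (rule limit_group_epimorphism[OF \<G> L])
  interpret q: group_hom G L q by fact
  have "\<forall>k\<in>{1..n}. \<exists>x\<in>carrier G. q x = g k"
    using q(2) g by (metis Pi_mem imageE)
  then obtain u where u: "u \<in> {1..n} \<rightarrow> carrier G" and qu: "\<And>k. k \<in> {1..n} \<Longrightarrow> q (u k) = g k"
    by (metis Pi_I)
  let ?v = "\<lambda>i. restrict (snd (\<Phi> i) \<circ> u) {1..n}"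
  have letters: "fst ` set V \<subseteq> {1..n}" if "V \<in> carrier (free_group n)" for V
    using that by (simp add: free_group_def)
  have \<phi>: "group_hom G (fst (\<Phi> i)) (snd (\<Phi> i))" for i
    using spec[OF \<Phi>, of i] \<G> q.G.is_group
    by (auto simp: Hom_family_def group_hom_def group_hom_axioms_def)
  have key: "word_value L g V = \<one>\<^bsub>L\<^esub> \<longleftrightarrow>
      eventually (\<lambda>i. word_value (fst (\<Phi> i)) (?v i) V = \<one>\<^bsub>fst (\<Phi> i)\<^esub>) \<omega>"
    if V: "V \<in> carrier (free_group n)" for V
  proof -
    have "word_value L g V = q (word_value G u V)"
      unfolding q.hom_word_value[OF u letters[OF V]]
      by (rule word_value_cong[OF letters[OF V]]) (simp add: qu)
    moreover have "word_value G u V \<in> carrier G"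
      by (rule q.G.word_value_closed[OF u letters[OF V]])
    moreover have "snd (\<Phi> i) (word_value G u V) = word_value (fst (\<Phi> i)) (?v i) V" for i
      unfolding group_hom.hom_word_value[OF \<phi> u letters[OF V]]
      by (rule word_value_cong[OF letters[OF V]]) simp
    moreover have "q x = \<one>\<^bsub>L\<^esub> \<longleftrightarrow> eventually (\<lambda>i. snd (\<Phi> i) x = \<one>\<^bsub>fst (\<Phi> i)\<^esub>) \<omega>"
      if "x \<in> carrier G" for x
      using ker that unfolding kernel_def stable_kernel_def by blast
    ultimately show ?thesis
      by simp
  qed
  have "eventually (\<lambda>i. \<forall>V\<in>S. word_value (fst (\<Phi> i)) (?v i) V = \<one>\<^bsub>fst (\<Phi> i)\<^esub>) \<omega>"
    using S sol key by (intro eventually_ball_finite) blast+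
  then have "eventually (\<lambda>i. word_value (fst (\<Phi> i)) (?v i) W = \<one>\<^bsub>fst (\<Phi> i)\<^esub>) \<omega>"
  proof (rule eventually_mono)
    fix i assume V: "\<forall>V\<in>S. word_value (fst (\<Phi> i)) (?v i) V = \<one>\<^bsub>fst (\<Phi> i)\<^esub>"
    have "fst (\<Phi> i) \<in> \<G>"
      using spec[OF \<Phi>, of i] by (auto simp: Hom_family_def)
    moreover have "?v i \<in> {1..n} \<rightarrow>\<^sub>E carrier (fst (\<Phi> i))"
      using Pi_mem[OF u] group_hom.hom_closed[OF \<phi>[of i]] by (simp add: PiE_def Pi_def)
    ultimately have "(fst (\<Phi> i), ?v i) \<in> solutions \<G> n S"
      using V by (simp add: solutions_def)
    then have "(fst (\<Phi> i), ?v i) \<in> solutions \<G> n {W}"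
      using conseq by blast
    then show "word_value (fst (\<Phi> i)) (?v i) W = \<one>\<^bsub>fst (\<Phi> i)\<^esub>"
      by (simp add: solutions_def)
  qed
  then show ?thesis
    using key[OF W] by simp
qed

section \<open>Chains of surjections\<close>

theorem theorem3p12:
  fixes \<omega> :: "nat filter"
    and \<G> :: "'a monoid set"
    and L :: "nat \<Rightarrow> 'l monoid"
    and \<alpha> :: "nat \<Rightarrow> 'l \<Rightarrow> 'l"
  assumes "nonprincipal_ultrafilter \<omega>"
    and "\<And>\<Gamma>. \<Gamma> \<in> \<G> \<Longrightarrow> group \<Gamma>"
    and "equationally_noetherian \<G>"
    and "\<And>j. j \<ge> 1 \<Longrightarrow> limit_group TYPE('g) \<omega> \<G> (L j)"
    and "\<And>j. j \<ge> 1 \<Longrightarrow> \<alpha> j \<in> epi (L j) (L (Suc j))"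
  shows "finite {j. j \<ge> 1 \<and> \<alpha> j \<notin> iso (L j) (L (Suc j))}"
proof -
  obtain n h where h: "h \<in> {1..n} \<rightarrow> carrier (L 1)"
    and h_surj: "word_value (L 1) h ` carrier (free_group n) = carrier (L 1)"
    by (rule limit_group_generating_tuple[OF assms(2) assms(4)[OF order_refl]])
  \<comment> \<open>The image of the tuple \<open>h\<close> in \<open>L j\<close>; the value at \<open>j = 0\<close> is a dummy.\<close>
  define g where "g = rec_nat h (\<lambda>j f. if j = 0 then h else \<alpha> j \<circ> f)"
  have g1: "g 1 = h" and g_Suc: "\<And>j. j \<ge> 1 \<Longrightarrow> g (Suc j) = \<alpha> j \<circ> g j"
    by (simp_all add: g_def)
  have grp: "group (L j)" if "j \<ge> 1" for j
    using assms(4)[OF that] by (simp add: limit_group_def)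
  have \<alpha>: "group_hom (L j) (L (Suc j)) (\<alpha> j)" "\<alpha> j ` carrier (L j) = carrier (L (Suc j))"
    if "j \<ge> 1" for j
    using assms(5)[OF that] grp[of j] grp[of "Suc j"] that
    by (auto simp: epi_def group_hom_def group_hom_axioms_def)
  have g: "g j \<in> {1..n} \<rightarrow> carrier (L j)" if "j \<ge> 1" for j
    using that
  proof (induction j rule: dec_induct)
    case (step j)
    then show ?case
      using group_hom.hom_closed[OF \<alpha>(1)[of j]] by (auto simp: g_Suc)
  qed (use h g1 in simp)
  have push: "word_value (L (Suc j)) (g (Suc j)) W = \<alpha> j (word_value (L j) (g j) W)"
    if "j \<ge> 1" "W \<in> carrier (free_group n)" for j W
    using that group_hom.hom_word_value[OF \<alpha>(1) g, of j W] by (simp add: g_Suc free_group_def)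
  have surj: "word_value (L j) (g j) ` carrier (free_group n) = carrier (L j)" if "j \<ge> 1" for j
    using that
  proof (induction j rule: dec_induct)
    case (step j)
    have "word_value (L (Suc j)) (g (Suc j)) ` carrier (free_group n)
        = \<alpha> j ` word_value (L j) (g j) ` carrier (free_group n)"
      unfolding image_image using step by (intro image_cong refl push) auto
    then show ?case
      using step \<alpha>(2) by simp
  qed (use h_surj g1 in simp)
  define R where "R j = {W \<in> carrier (free_group n). word_value (L j) (g j) W = \<one>\<^bsub>L j\<^esub>}" for j
  \<comment> \<open>An equation that holds at a tuple holds at its image under \<open>\<alpha> j\<close>.\<close>
  have R_mono: "R i \<subseteq> R j" if "1 \<le> i" "i \<le> j" for i j
    using that(2,1)
  proof (induction j rule: dec_induct)
    case (step j)
    then have "R j \<subseteq> R (Suc j)"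
      using group_hom.hom_one[OF \<alpha>(1)[of j]] by (auto simp: R_def push)
    with step show ?case by blast
  qed simp
  define S where "S = (\<Union>j\<in>{1..}. R j)"
  have "S \<subseteq> carrier (free_group n)"
    by (auto simp: S_def R_def)
  then obtain S\<^sub>0 where S\<^sub>0: "S\<^sub>0 \<subseteq> S" "finite S\<^sub>0" "solutions \<G> n S\<^sub>0 = solutions \<G> n S"
    using assms(3) unfolding equationally_noetherian_def by blast
  obtain J where J: "J \<ge> 1" "S\<^sub>0 \<subseteq> R J"
  proof -
    have "\<forall>V\<in>S\<^sub>0. \<exists>j\<ge>1. V \<in> R j"
      using S\<^sub>0(1) by (auto simp: S_def)
    then obtain t where t: "\<And>V. V \<in> S\<^sub>0 \<Longrightarrow> t V \<ge> 1 \<and> V \<in> R (t V)"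
      by metis
    have "S\<^sub>0 \<subseteq> R (Max (insert 1 (t ` S\<^sub>0)))"
    proof
      fix V assume V: "V \<in> S\<^sub>0"
      then have "t V \<le> Max (insert 1 (t ` S\<^sub>0))"
        using S\<^sub>0(2) by (intro Max_ge) auto
      then show "V \<in> R (Max (insert 1 (t ` S\<^sub>0)))"
        using t[OF V] R_mono by blast
    qed
    moreover have "Max (insert 1 (t ` S\<^sub>0)) \<ge> 1"
      using S\<^sub>0(2) by (intro Max_ge) auto
    ultimately show ?thesis using that by blast
  qed
  have stable: "S \<subseteq> R j" if "j \<ge> J" for j
  proof
    fix W assume W: "W \<in> S"
    have j: "j \<ge> 1" "S\<^sub>0 \<subseteq> R j"
      using that J R_mono[of J j] by auto
    have "word_value (L j) (g j) W = \<one>\<^bsub>L j\<^esub>"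
    proof (rule limit_group_inherits_consequences[OF assms(2) assms(4)[OF j(1)] g[OF j(1)] S\<^sub>0(2)])
      show "solutions \<G> n S\<^sub>0 \<subseteq> solutions \<G> n {W}"
        using W S\<^sub>0(3) by (auto simp: solutions_def)
    qed (use W j \<open>S \<subseteq> carrier (free_group n)\<close> S\<^sub>0(1) in \<open>auto simp: R_def\<close>)
    then show "W \<in> R j"
      using W \<open>S \<subseteq> carrier (free_group n)\<close> by (auto simp: R_def)
  qed
  \<comment> \<open>An element of the kernel of \<open>\<alpha> j\<close> is the value at \<open>g j\<close> of a word in \<open>R (Suc j)\<close>, and this
    word already lies in \<open>R j\<close>.\<close>
  have "\<alpha> j \<in> iso (L j) (L (Suc j))" if "j \<ge> J" for j
  proof -
    have j: "j \<ge> 1" using that J by simp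
    interpret \<alpha>: group_hom "L j" "L (Suc j)" "\<alpha> j" by (rule \<alpha>(1)[OF j])
    have "x = \<one>\<^bsub>L j\<^esub>" if x: "x \<in> carrier (L j)" "\<alpha> j x = \<one>\<^bsub>L (Suc j)\<^esub>" for x
    proof -
      obtain W where W: "W \<in> carrier (free_group n)" "x = word_value (L j) (g j) W"
        using x(1) surj[OF j] by blast
      then have "W \<in> R (Suc j)"
        using x(2) push[OF j] by (simp add: R_def)
      then have "W \<in> R j"
        using stable[OF \<open>j \<ge> J\<close>] by (auto simp: S_def)
      then show ?thesis
        using W(2) by (simp add: R_def)
    qed
    then have "inj_on (\<alpha> j) (carrier (L j))"
      by (simp add: \<alpha>.inj_on_one_iff)
    then show ?thesis
      using \<alpha>(2)[OF j] \<alpha>.homh by (simp add: iso_def bij_betw_def)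
  qed
  then have "{j. j \<ge> 1 \<and> \<alpha> j \<notin> iso (L j) (L (Suc j))} \<subseteq> {..<J}"
    by (auto simp: not_less[symmetric])
  then show ?thesis
    by (rule finite_subset) simp
qed

end
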